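(* Let $A\in\mathbb{R}^{d\times d}$ be symmetric, $b\in\mathbb{R}^d$, $\rho>0$, and let $f(x)=\frac12x^TAx+b^Tx+\frac{\rho}{3}\|x\|^3$ with global minimizer $x_\star$. Let $(x_t)_{t\ge0}$ be the gradient descent iterates $x_{t+1}=x_t-\eta\nabla f(x_t)=x_t-\eta(Ax_t+b+\rho\|x_t\|x_t)$ with $x_0=-r\,b/\|b\|$ for some $r\in[0,R_c]$ and step size $0<\eta\le\frac{1}{4(\beta+\rho R_\rho)}$. Suppose $b^{(1)}\neq0$ and $\varepsilon>0$. Define $$\tau_{\mathrm{grow}}=6\log\left(1+\frac{(-\lambda_{\min})_+^2}{4\rho|b^{(1)}|}\right),\qquad \tau_{\mathrm{converge}}(\varepsilon)=6\log\left(\frac{(\beta+2\rho\|x_\star\|)\|x_\star\|^2}{\varepsilon}\right).$$ Then $f(x_t)\le f(x_\star)+\varepsilon$ for all integers $t\ge0$ with $$t\ \ge\ \frac{\tau_{\mathrm{grow}}+\tau_{\mathrm{converge}}(\varepsilon)}{\eta}\,\min\left\{\frac{1}{\rho\|x_\star\|+\lambda_{\min}},\ \frac{10\|x_\star\|^2}{\varepsilon}\right\}.$$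
   Context: $\|\cdot\|$ is the Euclidean norm (operator norm for matrices) and $(s)_+=\max\{s,0\}$. $A$ has eigenvalues $\lambda^{(1)}\le\cdots\le\lambda^{(d)}$ with corresponding orthonormal eigenvectors $v_1,\dots,v_d$; $\lambda_{\min}=\lambda^{(1)}$; for $w\in\mathbb{R}^d$, $w^{(i)}=v_i^Tw$. $\beta$ is $\|A\|$, or any number with $\beta\ge\|A\|$. The constants are $$R_\rho=\frac{\beta}{2\rho}+\sqrt{\left(\frac{\beta}{2\rho}\right)^2+\frac{\|b\|}{\rho}},\qquad R_c=\frac{-b^TAb}{2\rho\|b\|^2}+\sqrt{\left(\frac{b^TAb}{2\rho\|b\|^2}\right)^2+\frac{\|b\|}{\rho}}.$$ When $b^{(1)}\ne0$ the global minimizer is unique and $\rho\|x_\star\|+\lambda_{\min}>0$. *)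

theory Defs
  imports "HOL-Analysis.Analysis"
begin

definition cubic_obj :: "real ^ 'n ^ 'n \<Rightarrow> real ^ 'n \<Rightarrow> real \<Rightarrow> real ^ 'n \<Rightarrow> real" where
  "cubic_obj A b \<rho> x = 1 / 2 * (x \<bullet> (A *v x)) + b \<bullet> x + \<rho> / 3 * norm x ^ 3"

definition cubic_grad :: "real ^ 'n ^ 'n \<Rightarrow> real ^ 'n \<Rightarrow> real \<Rightarrow> real ^ 'n \<Rightarrow> real ^ 'n" where
  "cubic_grad A b \<rho> x = A *v x + b + (\<rho> * norm x) *\<^sub>R x"

lemma norm_cube_has_derivative:
  fixes x :: "'a :: real_inner"
  shows "((\<lambda>y. norm y ^ 3) has_derivative (\<lambda>h. 3 * norm x * (x \<bullet> h))) (at x)"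
proof (cases "x = 0")
  case True
  have "((\<lambda>h. norm h ^ 3 / norm h) \<longlongrightarrow> 0) (at (0 :: 'a))"
  proof (rule Lim_transform_eventually)
    have "((\<lambda>h. norm h ^ 2) \<longlongrightarrow> norm (0 :: 'a) ^ 2) (at (0 :: 'a))"
      by (intro tendsto_intros)
    then show "((\<lambda>h. norm h ^ 2) \<longlongrightarrow> 0) (at (0 :: 'a))" by simp
    show "\<forall>\<^sub>F h in at (0 :: 'a). norm h ^ 2 = norm h ^ 3 / norm h"
      by (auto simp: eventually_at_filter power2_eq_square power3_eq_cube)
  qed
  then show ?thesis
    using True by (simp add: has_derivative_at)
next
  case False
  have "((\<lambda>y. norm y ^ 3) has_derivative (\<lambda>h. 3 * norm x ^ 2 * (sgn x \<bullet> h))) (at x)"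
    using False by (auto intro!: derivative_eq_intros GDERIV_norm[unfolded gderiv_def] simp: inner_commute)
  moreover have "3 * norm x ^ 2 * (sgn x \<bullet> h) = 3 * norm x * (x \<bullet> h)" for h
    using False by (simp add: sgn_div_norm power2_eq_square)
  ultimately show ?thesis by simp
qed

lemma GDERIV_cubic_obj:
  fixes A :: "real ^ 'n ^ 'n"
  assumes "transpose A = A"
  shows "GDERIV (cubic_obj A b \<rho>) x :> cubic_grad A b \<rho> x"
proof -
  have sym: "x \<bullet> (A *v h) = (A *v x) \<bullet> h" for h
    by (metis assms dot_lmul_matrix transpose_matrix_vector)
  have lin: "((\<lambda>y. A *v y) has_derivative (\<lambda>h. A *v h)) (at x)"
    by (rule bounded_linear_imp_has_derivative) (rule matrix_vector_mul_bounded_linear)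
  have "(cubic_obj A b \<rho> has_derivative
      (\<lambda>h. 1 / 2 * (x \<bullet> (A *v h) + h \<bullet> (A *v x)) + b \<bullet> h
            + \<rho> / 3 * (3 * norm x * (x \<bullet> h)))) (at x)"
    unfolding cubic_obj_def[abs_def]
    by (intro has_derivative_add has_derivative_mult_right has_derivative_inner
        has_derivative_inner_right has_derivative_ident lin norm_cube_has_derivative)
  moreover have "(\<lambda>h. 1 / 2 * (x \<bullet> (A *v h) + h \<bullet> (A *v x)) + b \<bullet> h
            + \<rho> / 3 * (3 * norm x * (x \<bullet> h))) = (\<lambda>h. h \<bullet> cubic_grad A b \<rho> x)"
    by (rule ext) (simp add: sym cubic_grad_def inner_add_right inner_commute algebra_simps)
  ultimately show ?thesis
    by (simp add: gderiv_def inner_commute)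
qed

text \<open>Orthonormal eigenvectors of \<open>A\<close> with eigenvalues in nondecreasing order, indexed by
  \<open>1, \<dots>, d\<close> with \<open>d = CARD('n)\<close>; values outside this range are irrelevant.\<close>

definition ordered_eigenbasis ::
    "real ^ 'n ^ 'n \<Rightarrow> (nat \<Rightarrow> real) \<Rightarrow> (nat \<Rightarrow> real ^ 'n) \<Rightarrow> bool" where
  "ordered_eigenbasis A lam v \<longleftrightarrow>
     mono_on {1..CARD('n)} lam \<and>
     (\<forall>i\<in>{1..CARD('n)}. A *v v i = lam i *\<^sub>R v i) \<and>
     (\<forall>i\<in>{1..CARD('n)}. \<forall>j\<in>{1..CARD('n)}. v i \<bullet> v j = (if i = j then 1 else 0))"

definition R_rho :: "real ^ 'n \<Rightarrow> real \<Rightarrow> real \<Rightarrow> real" where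
  "R_rho b \<rho> \<beta> = \<beta> / (2 * \<rho>) + sqrt ((\<beta> / (2 * \<rho>))\<^sup>2 + norm b / \<rho>)"

text \<open>For \<open>b = 0\<close> the quotients take the value \<open>0\<close>; \<open>R_c\<close> is only meaningful for \<open>b \<noteq> 0\<close>.\<close>

definition R_c :: "real ^ 'n ^ 'n \<Rightarrow> real ^ 'n \<Rightarrow> real \<Rightarrow> real" where
  "R_c A b \<rho> =
     - (b \<bullet> (A *v b)) / (2 * \<rho> * (norm b)\<^sup>2)
     + sqrt (((b \<bullet> (A *v b)) / (2 * \<rho> * (norm b)\<^sup>2))\<^sup>2 + norm b / \<rho>)"

definition tau_grow :: "real \<Rightarrow> real \<Rightarrow> real \<Rightarrow> real" where
  "tau_grow \<rho> lmin b1 = 6 * ln (1 + (max (- lmin) 0)\<^sup>2 / (4 * \<rho> * \<bar>b1\<bar>))"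

definition tau_converge :: "real \<Rightarrow> real \<Rightarrow> real ^ 'n \<Rightarrow> real \<Rightarrow> real" where
  "tau_converge \<rho> \<beta> xstar \<epsilon> =
     6 * ln ((\<beta> + 2 * \<rho> * norm xstar) * (norm xstar)\<^sup>2 / \<epsilon>)"

end

theory Submission
  imports Defs
begin

text \<open>Write \<open>a\<close> for the norm of the minimizer \<open>s\<close> and \<open>g = \<rho> a + \<lambda>\<^sub>m\<^sub>i\<^sub>n\<close>, which is positive. In the
  eigenbasis the gradient step acts on each coordinate by a scalar recursion that is coupled to the
  others only through \<open>norm (x t)\<close>, and the order of the eigenvalues is reflected in the order of the
  gradient coefficients. This forces \<open>x t \<bullet> \<nabla>f (x t) \<le> 0\<close> for all \<open>t\<close>, so the norms of the iterates
  increase, and they stay below \<open>a\<close>.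

  Put \<open>M = max g (\<epsilon> / (10 a\<^sup>2))\<close>. As long as \<open>\<rho> norm (x t) < - \<lambda>\<^sub>m\<^sub>i\<^sub>n - M / 3\<close>, the first coordinate grows
  geometrically with ratio \<open>1 + \<eta> M / 3\<close>, which can last only for \<open>\<tau>\<^sub>g\<^sub>r\<^sub>o\<^sub>w / (\<eta> M)\<close> steps. Afterwards
  \<open>norm (\<nabla>f (x t))\<^sup>2 \<ge> 2 / 9 M (f (x t) - f s)\<close> as long as \<open>f (x t) - f s > \<epsilon>\<close>, and since each step
  decreases \<open>f\<close> by at least \<open>3 / 4 \<eta> norm (\<nabla>f (x t))\<^sup>2\<close>, the optimality gap contracts by the factor
  \<open>1 - \<eta> M / 6\<close>.\<close>

section \<open>Expansion of the objective at general and at stationary points\<close>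

lemma symmetric_inner_matrix:
  fixes A :: "real ^ 'n ^ 'n"
  assumes "transpose A = A"
  shows "(A *v u) \<bullet> w = u \<bullet> (A *v w)"
  by (metis assms dot_lmul_matrix transpose_matrix_vector)

text \<open>Polarization expresses \<open>x \<bullet> h\<close> through norms, so the expansion is
  exact; for \<open>\<rho> \<ge> 0\<close> its last summand is nonnegative. Both the optimality gap
  and the descent estimate come from it.\<close>

lemma cubic_obj_add:
  fixes A :: "real ^ 'n ^ 'n"
  assumes "transpose A = A"
  shows "cubic_obj A b \<rho> (x + h) =
    cubic_obj A b \<rho> x + cubic_grad A b \<rho> x \<bullet> h + 1 / 2 * (h \<bullet> (A *v h))
    + \<rho> / 3 * ((norm (x + h) - norm x)\<^sup>2 * (norm (x + h) + norm x / 2)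
               + 3 / 2 * norm x * (norm h)\<^sup>2)"
proof -
  have sq: "2 * (x \<bullet> h) = (norm (x + h))\<^sup>2 - (norm x)\<^sup>2 - (norm h)\<^sup>2"
    unfolding power2_norm_eq_inner by (simp add: inner_add inner_commute)
  have "h \<bullet> (A *v x) = x \<bullet> (A *v h)"
    using symmetric_inner_matrix[OF assms, of x h] by (simp add: inner_commute)
  then have quad: "1 / 2 * ((x + h) \<bullet> (A *v (x + h)))
      = 1 / 2 * (x \<bullet> (A *v x)) + x \<bullet> (A *v h) + 1 / 2 * (h \<bullet> (A *v h))"
    by (simp add: matrix_vector_right_distrib inner_add algebra_simps)
  have poly: "m ^ 3 = n ^ 3 + 3 * n * p + ((m - n)\<^sup>2 * (m + n / 2) + 3 / 2 * n * k)"
    if "2 * p = m\<^sup>2 - n\<^sup>2 - k" for m n p k :: real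
  proof -
    have p: "p = (m\<^sup>2 - n\<^sup>2 - k) / 2" using that by simp
    show ?thesis unfolding p by (simp add: field_simps power2_eq_square power3_eq_cube)
  qed
  have cube: "\<rho> / 3 * norm (x + h) ^ 3 = \<rho> / 3 * norm x ^ 3 + \<rho> * norm x * (x \<bullet> h)
      + \<rho> / 3 * ((norm (x + h) - norm x)\<^sup>2 * (norm (x + h) + norm x / 2)
               + 3 / 2 * norm x * (norm h)\<^sup>2)"
    unfolding poly[OF sq] by (simp add: algebra_simps)
  have grad: "cubic_grad A b \<rho> x \<bullet> h = x \<bullet> (A *v h) + b \<bullet> h + \<rho> * norm x * (x \<bullet> h)"
    by (simp add: cubic_grad_def inner_add_left symmetric_inner_matrix[OF assms])
  have lin: "b \<bullet> (x + h) = b \<bullet> x + b \<bullet> h" by (simp add: inner_add)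
  show ?thesis unfolding cubic_obj_def quad cube grad lin by linarith
qed

lemma cubic_grad_minimizer:
  fixes A :: "real ^ 'n ^ 'n"
  assumes "transpose A = A" "\<forall>y. cubic_obj A b \<rho> s \<le> cubic_obj A b \<rho> y"
  shows "cubic_grad A b \<rho> s = 0"
proof -
  have "(\<lambda>h. h \<bullet> cubic_grad A b \<rho> s) = (\<lambda>h. 0)"
    using GDERIV_cubic_obj[OF assms(1), of b \<rho> s] assms(2)
    by (intro differential_zero_maxmin[where f = "cubic_obj A b \<rho>" and S = UNIV and x = s])
      (auto simp: gderiv_def inner_commute)
  then show ?thesis
    by (metis inner_eq_zero_iff)
qed

text \<open>At a stationary point the first-order term vanishes. What remains is the quadratic form
  of \<open>A\<close> shifted by \<open>\<rho> * norm s\<close>, plus a term that sees only the two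
  norms.\<close>

lemma cubic_obj_gap:
  fixes A :: "real ^ 'n ^ 'n"
  assumes "transpose A = A" "cubic_grad A b \<rho> s = 0"
  shows "cubic_obj A b \<rho> y - cubic_obj A b \<rho> s =
    1 / 2 * ((y - s) \<bullet> (A *v (y - s)) + \<rho> * norm s * (norm (y - s))\<^sup>2)
    + \<rho> / 6 * (norm s - norm y)\<^sup>2 * (norm s + 2 * norm y)"
proof -
  have "\<rho> / 3 * ((m - n)\<^sup>2 * (m + n / 2) + 3 / 2 * n * k)
      = \<rho> * n * k / 2 + \<rho> / 6 * (n - m)\<^sup>2 * (n + 2 * m)" for m n k :: real
    by (simp add: field_simps power2_eq_square)
  then show ?thesis
    using cubic_obj_add[OF assms(1), of b \<rho> s "y - s"] assms(2)
    by (simp add: field_simps power2_commute[of "norm y" "norm s"])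
qed

lemma cubic_grad_stationary:
  fixes A :: "real ^ 'n ^ 'n"
  assumes "cubic_grad A b \<rho> s = 0"
  shows "cubic_grad A b \<rho> y =
    A *v (y - s) + (\<rho> * norm s) *\<^sub>R (y - s) - (\<rho> * (norm s - norm y)) *\<^sub>R y"
  using assms unfolding cubic_grad_def
  by (simp add: matrix_vector_mult_diff_distrib algebra_simps add_eq_0_iff2)
  
text \<open>Pairing the gradient with \<open>y - s\<close> produces the same ingredients as
  \<open>cubic_obj_gap\<close>, which makes gradient and gap comparable.\<close>

lemma inner_cubic_grad_stationary:
  fixes A :: "real ^ 'n ^ 'n"
  assumes "cubic_grad A b \<rho> s = 0"
  shows "(y - s) \<bullet> cubic_grad A b \<rho> y =
    (y - s) \<bullet> (A *v (y - s)) + \<rho> * (norm s + norm y) / 2 * (norm (y - s))\<^sup>2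
    + \<rho> / 2 * (norm s - norm y)\<^sup>2 * (norm s + norm y)"
proof -
  have "2 * ((y - s) \<bullet> y) = (norm (y - s))\<^sup>2 + (norm y)\<^sup>2 - (norm s)\<^sup>2"
    unfolding power2_norm_eq_inner by (simp add: inner_diff inner_commute)
  then have e: "(y - s) \<bullet> y = ((norm (y - s))\<^sup>2 + (norm y)\<^sup>2 - (norm s)\<^sup>2) / 2" by simp
  show ?thesis
    unfolding cubic_grad_stationary[OF assms] inner_diff_right inner_add_right inner_scaleR_right e
      power2_norm_eq_inner[symmetric]
    by (simp add: field_simps power2_eq_square power2_norm_eq_inner[symmetric])
qed

section \<open>Eigenbasis expansions and operator norm bounds\<close>

text \<open>Parseval: \<open>CARD('n)\<close> orthonormal vectors are independent and hence span the
  space.\<close>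

lemma eigenbasis_inner:
  fixes A :: "real ^ 'n ^ 'n"
  assumes "ordered_eigenbasis A lam v"
  shows "u \<bullet> w = (\<Sum>i = 1..CARD('n). (v i \<bullet> u) * (v i \<bullet> w))"
proof -
  let ?I = "{1..CARD('n)}"
  have on: "v i \<bullet> v j = (if i = j then 1 else 0)" if "i \<in> ?I" "j \<in> ?I" for i j
    using assms that by (simp add: ordered_eigenbasis_def)
  have inj: "inj_on v ?I"
  proof (rule inj_onI, rule ccontr)
    fix i j assume "i \<in> ?I" "j \<in> ?I" "v i = v j" "i \<noteq> j"
    then show False using on[of i j] on[of j j] by simp
  qed
  have orth: "pairwise orthogonal (v ` ?I)"
    unfolding pairwise_def orthogonal_def by (auto simp del: atLeastAtMost_iff simp: on)
  have "v i \<noteq> 0" if "i \<in> ?I" for i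
    using on[OF that that] by auto
  then have "0 \<notin> v ` ?I" by (metis imageE)
  then have "independent (v ` ?I)"
    using orth by (rule pairwise_orthogonal_independent[rotated])
  moreover have "card (v ` ?I) = DIM(real ^ 'n)"
    using inj by (simp add: card_image)
  ultimately have span: "span (v ` ?I) = UNIV"
    using card_ge_dim_independent[of "v ` ?I" UNIV] by (simp add: dim_UNIV top.extremum_unique)
  have "(\<Sum>e \<in> v ` ?I. (w \<bullet> e) *\<^sub>R e) = w"
  proof (rule orthonormal_basis_expand[OF orth])
    show "norm e = 1" if "e \<in> v ` ?I" for e
      using that on by (force simp: norm_eq_1)
    show "w \<in> span (v ` ?I)" unfolding span by simp
  qed simp
  then have "w = (\<Sum>i \<in> ?I. (v i \<bullet> w) *\<^sub>R v i)"
    unfolding sum.reindex[OF inj] by (simp add: inner_commute[of w])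
  then have "u \<bullet> w = u \<bullet> (\<Sum>i \<in> ?I. (v i \<bullet> w) *\<^sub>R v i)" by simp
  also have "\<dots> = (\<Sum>i \<in> ?I. (v i \<bullet> u) * (v i \<bullet> w))"
    by (simp add: inner_sum_right inner_commute mult.commute)
  finally show ?thesis .
qed

lemma eigenbasis_component:
  fixes A :: "real ^ 'n ^ 'n"
  assumes "transpose A = A" "ordered_eigenbasis A lam v" "i \<in> {1..CARD('n)}"
  shows "v i \<bullet> (A *v w) = lam i * (v i \<bullet> w)"
  using assms symmetric_inner_matrix[OF assms(1), of "v i" w]
  by (simp add: ordered_eigenbasis_def)

lemma eigenvalue_min_le:
  fixes A :: "real ^ 'n ^ 'n"
  assumes "transpose A = A" "ordered_eigenbasis A lam v"
  shows "lam 1 * (norm w)\<^sup>2 \<le> w \<bullet> (A *v w)"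
proof -
  have mono: "lam 1 \<le> lam i" if "i \<in> {1..CARD('n)}" for i
    using assms(2) that by (auto simp: ordered_eigenbasis_def intro: mono_onD)
  have "lam 1 * (norm w)\<^sup>2 = (\<Sum>i = 1..CARD('n). lam 1 * (v i \<bullet> w)\<^sup>2)"
    unfolding power2_norm_eq_inner eigenbasis_inner[OF assms(2), of w w]
    by (simp add: sum_distrib_left power2_eq_square)
  also have "\<dots> \<le> (\<Sum>i = 1..CARD('n). lam i * (v i \<bullet> w)\<^sup>2)"
    by (intro sum_mono mult_right_mono mono) auto
  also have "\<dots> = w \<bullet> (A *v w)"
    unfolding eigenbasis_inner[OF assms(2), of w "A *v w"]
    by (intro sum.cong) (auto simp: eigenbasis_component[OF assms] power2_eq_square)
  finally show ?thesis .
qed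

lemma norm_matrix_vector_le:
  fixes A :: "real ^ 'n ^ 'n"
  assumes "onorm (\<lambda>y. A *v y) \<le> \<beta>"
  shows "norm (A *v w) \<le> \<beta> * norm w"
  using onorm[OF matrix_vector_mul_bounded_linear, of A w] assms
  by (meson mult_right_mono norm_ge_zero order_trans)

lemma abs_quadratic_form_le:
  fixes A :: "real ^ 'n ^ 'n"
  assumes "onorm (\<lambda>y. A *v y) \<le> \<beta>"
  shows "\<bar>w \<bullet> (A *v w)\<bar> \<le> \<beta> * (norm w)\<^sup>2"
proof -
  have "\<bar>w \<bullet> (A *v w)\<bar> \<le> norm w * norm (A *v w)" by (rule Cauchy_Schwarz_ineq2)
  also have "\<dots> \<le> norm w * (\<beta> * norm w)"
    by (intro mult_left_mono norm_matrix_vector_le[OF assms]) auto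
  finally show ?thesis by (simp add: power2_eq_square mult_ac)
qed

text \<open>Completing the square: \<open>u\<close> is the larger root of
  \<open>w\<^sup>2 + 2 * c * w = k\<close>. Both \<open>R_rho\<close> and \<open>R_c\<close> have
  this shape with \<open>k = norm b / \<rho>\<close>.\<close>

lemma quadratic_root:
  fixes c k u :: real
  assumes "0 \<le> k" "u = - c + sqrt (c\<^sup>2 + k)"
  shows "u\<^sup>2 + 2 * c * u = k" "0 \<le> u"
    and "\<lbrakk>0 \<le> w; w \<le> u\<rbrakk> \<Longrightarrow> w\<^sup>2 + 2 * c * w \<le> k"
    and "\<lbrakk>w\<^sup>2 + 2 * c * w \<le> k\<rbrakk> \<Longrightarrow> w \<le> u"
proof -
  have s: "(u + c)\<^sup>2 = c\<^sup>2 + k" using assms by simp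
  then show "u\<^sup>2 + 2 * c * u = k" by (simp add: power2_eq_square algebra_simps)
  have uc: "0 \<le> u + c" using assms by simp
  have "\<bar>c\<bar> \<le> sqrt (c\<^sup>2 + k)" by (rule real_le_rsqrt) (simp add: assms)
  then show "0 \<le> u" using assms by simp
  have c: "- (u + c) \<le> c" using \<open>\<bar>c\<bar> \<le> sqrt (c\<^sup>2 + k)\<close> assms by simp
  show "w\<^sup>2 + 2 * c * w \<le> k" if "0 \<le> w" "w \<le> u"
  proof -
    have "\<bar>w + c\<bar> \<le> u + c" using that c by linarith
    then have "(w + c)\<^sup>2 \<le> (u + c)\<^sup>2" using uc by (simp add: abs_le_square_iff[symmetric])
    then show ?thesis unfolding s by (simp add: power2_eq_square algebra_simps)
  qed
  show "w \<le> u" if "w\<^sup>2 + 2 * c * w \<le> k"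
  proof -
    have "(w + c)\<^sup>2 \<le> (u + c)\<^sup>2" unfolding s using that by (simp add: power2_eq_square algebra_simps)
    then show ?thesis using uc power2_le_imp_le[of "w + c" "u + c"] by linarith
  qed
qed

section \<open>Constants and starting point of gradient descent\<close>

locale cubic_gradient_descent =
  fixes A :: "real ^ 'n ^ 'n"
    and b s :: "real ^ 'n"
    and \<rho> \<beta> \<eta> r :: real
    and lam :: "nat \<Rightarrow> real"
    and v x :: "nat \<Rightarrow> real ^ 'n"
  assumes sym: "transpose A = A"
    and rho_pos: "\<rho> > 0"
    and eigen: "ordered_eigenbasis A lam v"
    and onorm_le: "onorm (\<lambda>y. A *v y) \<le> \<beta>"
    and minimizer: "\<forall>y. cubic_obj A b \<rho> s \<le> cubic_obj A b \<rho> y"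
    and r_nonneg: "0 \<le> r"
    and r_le: "r \<le> R_c A b \<rho>"
    and eta_pos: "0 < \<eta>"
    and eta_le: "\<eta> \<le> 1 / (4 * (\<beta> + \<rho> * R_rho b \<rho> \<beta>))"
    and x_0: "x 0 = - (r *\<^sub>R (b /\<^sub>R norm b))"
    and x_Suc: "\<forall>t. x (Suc t) = x t - \<eta> *\<^sub>R cubic_grad A b \<rho> (x t)"
    and b1_nonzero: "v 1 \<bullet> b \<noteq> 0"
begin

abbreviation f :: "real ^ 'n \<Rightarrow> real" where "f \<equiv> cubic_obj A b \<rho>"
abbreviation grad :: "real ^ 'n \<Rightarrow> real ^ 'n" where "grad \<equiv> cubic_grad A b \<rho>"
abbreviation R :: real where "R \<equiv> R_rho b \<rho> \<beta>"

lemma one_in_I: "1 \<in> {1..CARD('n)}"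
  by (simp add: Suc_leI)

lemma lam_mono: "i \<in> {1..CARD('n)} \<Longrightarrow> j \<in> {1..CARD('n)} \<Longrightarrow> i \<le> j \<Longrightarrow> lam i \<le> lam j"
  using eigen by (auto simp: ordered_eigenbasis_def intro: mono_onD)

lemma lam_min_le: "i \<in> {1..CARD('n)} \<Longrightarrow> lam 1 \<le> lam i"
  using lam_mono[OF one_in_I] by simp

lemma v_unit: "i \<in> {1..CARD('n)} \<Longrightarrow> norm (v i) = 1"
  using eigen by (simp add: ordered_eigenbasis_def norm_eq_1)

lemma component: "i \<in> {1..CARD('n)} \<Longrightarrow> v i \<bullet> (A *v w) = lam i * (v i \<bullet> w)"
  by (rule eigenbasis_component[OF sym eigen])

lemma abs_component_le: "i \<in> {1..CARD('n)} \<Longrightarrow> \<bar>v i \<bullet> w\<bar> \<le> norm w"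
  using Cauchy_Schwarz_ineq2[of "v i" w] v_unit[of i] by simp

lemma lam_bound: "i \<in> {1..CARD('n)} \<Longrightarrow> \<bar>lam i\<bar> \<le> \<beta>"
  using abs_quadratic_form_le[OF onorm_le, of "v i"] component[of i "v i"] v_unit[of i]
  by (simp add: norm_eq_1)

lemma beta_nonneg: "0 \<le> \<beta>"
  using lam_bound[OF one_in_I] by linarith

lemma b_pos: "0 < norm b"
  using b1_nonzero by auto

text \<open>\<open>R\<close> is the larger root of
  \<open>\<rho> * w\<^sup>2 = \<beta> * w + norm b\<close>. The third fact serves to bound
  \<open>r\<close> and \<open>norm s\<close> by \<open>R\<close>.\<close>

lemma R_equation: "\<rho> * R\<^sup>2 = \<beta> * R + norm b" and R_nonneg: "0 \<le> R"
  and le_R: "\<rho> * w\<^sup>2 \<le> \<beta> * w + norm b \<Longrightarrow> w \<le> R"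
proof -
  have k: "0 \<le> norm b / \<rho>" using rho_pos by simp
  have e: "R = - (- \<beta> / (2 * \<rho>)) + sqrt ((- \<beta> / (2 * \<rho>))\<^sup>2 + norm b / \<rho>)"
    by (simp add: R_rho_def)
  note q = quadratic_root[OF k e]
  show "\<rho> * R\<^sup>2 = \<beta> * R + norm b" using q(1) rho_pos by (simp add: field_simps)
  show "0 \<le> R" by (rule q(2))
  show "w \<le> R" if "\<rho> * w\<^sup>2 \<le> \<beta> * w + norm b"
  proof (rule q(4))
    have "w\<^sup>2 \<le> (\<beta> * w + norm b) / \<rho>" using that rho_pos by (simp add: field_simps)
    then show "w\<^sup>2 + 2 * (- \<beta> / (2 * \<rho>)) * w \<le> norm b / \<rho>"
      using rho_pos by (simp add: add_divide_distrib)
  qed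
qed

lemma step_bound: "\<eta> * (\<beta> + \<rho> * R) \<le> 1 / 4"
proof -
  \<comment> \<open>\<open>R = 0\<close> would force \<open>norm b = 0\<close>. The denominator in
    \<open>eta_le\<close> is therefore positive and can be cleared.\<close>
  have "R \<noteq> 0" using R_equation b_pos by auto
  then have "0 < \<beta> + \<rho> * R"
    using R_nonneg beta_nonneg rho_pos by (simp add: add_nonneg_pos)
  then have "\<eta> * (4 * (\<beta> + \<rho> * R)) \<le> 1" using eta_le by (simp add: pos_le_divide_eq)
  then show ?thesis by linarith
qed

text \<open>\<open>R_c\<close> is the point of the ray through \<open>- b\<close> at which the
  derivative of \<open>f\<close> along the ray vanishes; up to that point the derivative is
  nonpositive.\<close>

lemma start_bound: "r * (b \<bullet> (A *v b)) / (norm b)\<^sup>2 + \<rho> * r\<^sup>2 \<le> norm b"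
proof -
  have k: "0 \<le> norm b / \<rho>" using rho_pos by simp
  have "R_c A b \<rho> = - ((b \<bullet> (A *v b)) / (2 * \<rho> * (norm b)\<^sup>2))
     + sqrt (((b \<bullet> (A *v b)) / (2 * \<rho> * (norm b)\<^sup>2))\<^sup>2 + norm b / \<rho>)"
    by (simp add: R_c_def)
  from quadratic_root(3)[OF k this r_nonneg r_le]
  have "\<rho> * (r\<^sup>2 + 2 * ((b \<bullet> (A *v b)) / (2 * \<rho> * (norm b)\<^sup>2)) * r) \<le> \<rho> * (norm b / \<rho>)"
    using rho_pos by (intro mult_left_mono) auto
  moreover have "\<rho> * (r\<^sup>2 + 2 * (c / (2 * \<rho> * d)) * r) = r * c / d + \<rho> * r\<^sup>2" for c d
    using rho_pos by (simp add: distrib_left)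
  ultimately show ?thesis using rho_pos by simp
qed

lemma norm_x_0: "norm (x 0) = r"
  using b_pos r_nonneg by (simp add: x_0)

lemma r_le_R: "r \<le> R"
proof (rule le_R)
  have "- (\<beta> * (norm b)\<^sup>2) \<le> b \<bullet> (A *v b)"
    using abs_quadratic_form_le[OF onorm_le, of b] by linarith
  then have "r * - (\<beta> * (norm b)\<^sup>2) \<le> r * (b \<bullet> (A *v b))"
    using r_nonneg by (rule mult_left_mono)
  then have "- (\<beta> * r) \<le> r * (b \<bullet> (A *v b)) / (norm b)\<^sup>2"
    using b_pos by (simp add: field_simps)
  then show "\<rho> * r\<^sup>2 \<le> \<beta> * r + norm b" using start_bound by linarith
qed

lemma start_quadratic: "x 0 \<bullet> (A *v x 0) = r * (r * (b \<bullet> (A *v b)) / (norm b)\<^sup>2)"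
proof -
  have "x 0 = (- (r / norm b)) *\<^sub>R b" by (simp add: x_0 divide_inverse)
  then show ?thesis
    by (simp add: matrix_vector_mult_scaleR power2_eq_square del: scaleR_minus_left)
qed

lemma start_linear: "b \<bullet> x 0 = - (r * norm b)"
  using b_pos by (simp add: x_0 power2_norm_eq_inner[symmetric] power2_eq_square)

lemma start_obj: "f (x 0) \<le> 0"
proof -
  define q where "q = r * (b \<bullet> (A *v b)) / (norm b)\<^sup>2"
  have "f (x 0) = r * (q / 2 - norm b + \<rho> * r\<^sup>2 / 3)"
    unfolding cubic_obj_def start_quadratic start_linear norm_x_0 q_def[symmetric]
    by (simp add: field_simps power2_eq_square power3_eq_cube)
  \<comment> \<open>Half of \<open>start_bound\<close> already leaves
    \<open>- norm b / 2 - \<rho> * r\<^sup>2 / 6\<close>.\<close>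
  moreover have "q / 2 - norm b + \<rho> * r\<^sup>2 / 3 \<le> 0"
    using start_bound b_pos rho_pos zero_le_power2[of r] mult_nonneg_nonneg[of \<rho> "r\<^sup>2"] unfolding q_def[symmetric] by linarith
  ultimately show ?thesis using r_nonneg by (simp add: mult_nonneg_nonpos)
qed

lemma start_slope: "x 0 \<bullet> grad (x 0) \<le> 0"
proof -
  define q where "q = r * (b \<bullet> (A *v b)) / (norm b)\<^sup>2"
  have "x 0 \<bullet> grad (x 0) = r * (q - norm b + \<rho> * r\<^sup>2)"
    unfolding cubic_grad_def inner_add_right start_quadratic q_def[symmetric]
      inner_commute[of "x 0" b] start_linear inner_scaleR_right power2_norm_eq_inner[symmetric] norm_x_0
    by (simp add: field_simps power2_eq_square)
  then show ?thesis
    using start_bound r_nonneg unfolding q_def[symmetric] by (simp add: mult_nonneg_nonpos)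
qed

section \<open>The minimizer: stationarity, norm bound and spectral gap\<close>

lemma stationary: "grad s = 0"
  by (rule cubic_grad_minimizer[OF sym minimizer])

lemma s_component: "i \<in> {1..CARD('n)} \<Longrightarrow> (\<rho> * norm s + lam i) * (v i \<bullet> s) = - (v i \<bullet> b)"
proof -
  assume i: "i \<in> {1..CARD('n)}"
  have "v i \<bullet> grad s = 0" by (simp add: stationary)
  then show ?thesis using component[OF i, of s]
    by (simp add: cubic_grad_def inner_add_right algebra_simps)
qed

lemma norm_s_le: "norm s \<le> R"
proof (rule le_R)
  have "(\<rho> * norm s) *\<^sub>R s = - (A *v s + b)"
    using stationary by (simp add: cubic_grad_def add_eq_0_iff2)
  then have "norm ((\<rho> * norm s) *\<^sub>R s) = norm (A *v s + b)" by (simp only: norm_minus_cancel)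
  also have "\<dots> \<le> \<beta> * norm s + norm b"
    using norm_triangle_ineq[of "A *v s" b] norm_matrix_vector_le[OF onorm_le, of s] by linarith
  finally show "\<rho> * (norm s)\<^sup>2 \<le> \<beta> * norm s + norm b"
    using rho_pos by (simp add: power2_eq_square)
qed

text \<open>Reflecting \<open>s\<close> in the hyperplane orthogonal to \<open>v 1\<close> keeps the norm, so that only the
  quadratic part of the optimality gap remains.\<close>

lemma gap_pos: "0 < \<rho> * norm s + lam 1"
proof -
  define c where "c = v 1 \<bullet> s"
  define y where "y = s - (2 * c) *\<^sub>R v 1"
  \<comment> \<open>Both factors matter: \<open>c \<noteq> 0\<close> makes the reflection move
    \<open>s\<close>, and the other factor being nonzero makes the final inequality strict.\<close>
  have nz: "(\<rho> * norm s + lam 1) * c \<noteq> 0"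
    using s_component[OF one_in_I] b1_nonzero by (simp add: c_def)
  have v: "v 1 \<bullet> v 1 = 1" using v_unit[OF one_in_I] by (simp add: norm_eq_1)
  have vs: "v 1 \<bullet> s = c" and sv: "s \<bullet> v 1 = c" by (simp_all add: c_def inner_commute)
  have "(norm y)\<^sup>2 = (norm s)\<^sup>2"
    unfolding power2_norm_eq_inner y_def inner_diff_left inner_diff_right
      inner_scaleR_left inner_scaleR_right v vs sv by simp
  then have ny: "norm y = norm s" by simp
  have ys: "y - s = - (2 * c) *\<^sub>R v 1" by (simp add: y_def)
  have "f y - f s = 1 / 2 * ((y - s) \<bullet> (A *v (y - s)) + \<rho> * norm s * (norm (y - s))\<^sup>2)"
    by (simp add: cubic_obj_gap[OF sym stationary] ny)
  also have "\<dots> = 2 * c\<^sup>2 * (\<rho> * norm s + lam 1)"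
    unfolding power2_norm_eq_inner ys matrix_vector_mult_scaleR inner_scaleR_left inner_scaleR_right
      component[OF one_in_I] v
    by (simp add: power2_eq_square algebra_simps)
  finally have "0 \<le> 2 * c\<^sup>2 * (\<rho> * norm s + lam 1)" using minimizer[rule_format, of y] by linarith
  moreover have "0 < 2 * c\<^sup>2" using nz by auto
  ultimately have "0 \<le> \<rho> * norm s + lam 1" by (simp add: zero_le_mult_iff)
  then show ?thesis using nz by auto
qed

lemma s_pos: "0 < norm s"
  using s_component[OF one_in_I] b1_nonzero by auto

lemma shifted_lam_pos: "i \<in> {1..CARD('n)} \<Longrightarrow> 0 < \<rho> * norm s + lam i"
  using gap_pos lam_min_le[of i] by linarith

section \<open>Boundedness of the iterates\<close>

lemma norm_x_le_R: "norm (x t) \<le> R"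
proof (induction t)
  case 0
  then show ?case by (simp add: norm_x_0 r_le_R)
next
  case (Suc t)
  define n where "n = norm (x t)"
  have n: "0 \<le> n" "n \<le> R" using Suc by (simp_all add: n_def)
  have "\<eta> * (\<rho> * n) \<le> \<eta> * (\<rho> * R)"
    using n eta_pos rho_pos by (intro mult_left_mono) auto
  moreover have "0 \<le> \<eta> * \<beta>" using eta_pos beta_nonneg by simp
  ultimately have small: "\<eta> * (\<rho> * n) \<le> 1 / 4" "\<eta> * (\<rho> * R) \<le> 1 / 4"
    using step_bound by (simp_all add: distrib_left)
  have "x (Suc t) = (1 - \<eta> * (\<rho> * n)) *\<^sub>R x t - \<eta> *\<^sub>R (A *v x t + b)"
    by (simp add: x_Suc cubic_grad_def n_def algebra_simps)
  then have "norm (x (Suc t)) \<le> norm ((1 - \<eta> * (\<rho> * n)) *\<^sub>R x t) + norm (\<eta> *\<^sub>R (A *v x t + b))"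
    by (metis norm_triangle_ineq4)
  also have "\<dots> = (1 - \<eta> * (\<rho> * n)) * n + \<eta> * norm (A *v x t + b)"
    using small eta_pos by (simp add: n_def)
  also have "\<dots> \<le> (1 - \<eta> * (\<rho> * n)) * n + \<eta> * (\<beta> * n + norm b)"
    using norm_triangle_ineq[of "A *v x t" b] norm_matrix_vector_le[OF onorm_le, of "x t"] eta_pos
    by (intro add_left_mono mult_left_mono) (auto simp: n_def)
  \<comment> \<open>Expansion around the fixed point \<open>R\<close> of the scalar bound: the last
    bracket vanishes by \<open>R_equation\<close>, and the factor next to \<open>R - n\<close> is at
    least 1/2.\<close>
  also have "\<dots> = R - (R - n) * (1 + \<eta> * \<beta> - \<eta> * (\<rho> * R) - \<eta> * (\<rho> * n))
      + \<eta> * (\<beta> * R + norm b - \<rho> * R\<^sup>2)"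
    by (simp add: algebra_simps power2_eq_square)
  also have "\<dots> = R - (R - n) * (1 + \<eta> * \<beta> - \<eta> * (\<rho> * R) - \<eta> * (\<rho> * n))"
    using R_equation by simp
  also have "\<dots> \<le> R"
    using n small \<open>0 \<le> \<eta> * \<beta>\<close> by (simp add: mult_nonneg_nonneg)
  finally show ?case .
qed

section \<open>Coordinates of the iterates in the eigenbasis\<close>

text \<open>In the eigenbasis the iterates are \<open>- coef i t * (v i \<bullet> b)\<close>, with coefficients that depend on \<open>i\<close>
  only through the eigenvalue; \<open>resid i t\<close> is the corresponding coefficient of the gradient.\<close>

definition shrink :: "nat \<Rightarrow> nat \<Rightarrow> real" where
  "shrink i t = 1 - \<eta> * (lam i + \<rho> * norm (x t))"

primrec coef :: "nat \<Rightarrow> nat \<Rightarrow> real" where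
  "coef i 0 = r / norm b"
| "coef i (Suc t) = shrink i t * coef i t + \<eta>"

definition resid :: "nat \<Rightarrow> nat \<Rightarrow> real" where
  "resid i t = 1 - (lam i + \<rho> * norm (x t)) * coef i t"

lemma shrink_lower:
  assumes "i \<in> {1..CARD('n)}"
  shows "3 / 4 \<le> shrink i t"
proof -
  have "\<rho> * norm (x t) \<le> \<rho> * R" using norm_x_le_R rho_pos by (intro mult_left_mono) auto
  then have "lam i + \<rho> * norm (x t) \<le> \<beta> + \<rho> * R" using lam_bound[OF assms] by linarith
  then have "\<eta> * (lam i + \<rho> * norm (x t)) \<le> \<eta> * (\<beta> + \<rho> * R)"
    using eta_pos by (intro mult_left_mono) auto
  then show ?thesis using step_bound by (simp add: shrink_def)
qed

lemma shrink_antimono: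
  assumes "i \<in> {1..CARD('n)}" "j \<in> {1..CARD('n)}" "i \<le> j"
  shows "shrink j t \<le> shrink i t"
  using lam_mono[OF assms] eta_pos by (simp add: shrink_def)

lemma coef_nonneg: "i \<in> {1..CARD('n)} \<Longrightarrow> 0 \<le> coef i t"
proof (induction t)
  case 0
  then show ?case using r_nonneg by simp
next
  case (Suc t)
  then show ?case using shrink_lower[of i t] eta_pos by simp
qed

lemma coef_Suc_resid: "coef i (Suc t) = coef i t + \<eta> * resid i t"
  by (simp add: shrink_def resid_def algebra_simps)

text \<open>The coupling between coordinates is confined to the last term, which has a known sign
  once the norms are known to increase.\<close>

lemma resid_Suc:
  "resid i (Suc t) = shrink i t * resid i t - \<rho> * (norm (x (Suc t)) - norm (x t)) * coef i (Suc t)"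
  unfolding resid_def coef.simps shrink_def by (simp add: algebra_simps)

lemma x_component:
  assumes "i \<in> {1..CARD('n)}"
  shows "v i \<bullet> x t = - (coef i t * (v i \<bullet> b))"
proof (induction t)
  case 0
  then show ?case by (simp add: x_0 divide_inverse)
next
  case (Suc t)
  have "v i \<bullet> x (Suc t) = shrink i t * (v i \<bullet> x t) - \<eta> * (v i \<bullet> b)"
    using component[OF assms, of "x t"]
    by (simp add: x_Suc cubic_grad_def inner_diff_right inner_add_right shrink_def algebra_simps)
  then show ?case by (simp add: Suc algebra_simps)
qed

lemma grad_component:
  assumes "i \<in> {1..CARD('n)}"
  shows "v i \<bullet> grad (x t) = resid i t * (v i \<bullet> b)"
  using component[OF assms, of "x t"] x_component[OF assms, of t]
  by (simp add: cubic_grad_def inner_add_right resid_def algebra_simps)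

lemma norm_x_sum: "(norm (x t))\<^sup>2 = (\<Sum>i = 1..CARD('n). (v i \<bullet> b)\<^sup>2 * (coef i t)\<^sup>2)"
  unfolding power2_norm_eq_inner eigenbasis_inner[OF eigen, of "x t" "x t"]
  by (intro sum.cong) (simp_all add: x_component power2_eq_square)

text \<open>Turns slope conditions into weighted sums with nonnegative weights. The two times are
  separate because \<open>slope_Suc\<close> pairs the new point with the old gradient.\<close>

lemma x_grad_sum: "x t \<bullet> grad (x t') = - (\<Sum>i = 1..CARD('n). (v i \<bullet> b)\<^sup>2 * (coef i t * resid i t'))"
  unfolding eigenbasis_inner[OF eigen, of "x t" "grad (x t')"] sum_negf[symmetric]
  by (intro sum.cong) (simp_all add: x_component grad_component power2_eq_square)

section \<open>Monotonicity of the norms\<close>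

lemma norm_x_Suc:
  "(norm (x (Suc t)))\<^sup>2 = (norm (x t))\<^sup>2 - 2 * \<eta> * (x t \<bullet> grad (x t)) + \<eta>\<^sup>2 * (norm (grad (x t)))\<^sup>2"
  unfolding power2_norm_eq_inner
  by (simp add: x_Suc inner_diff inner_commute[of "grad (x t)" "x t"] power2_eq_square algebra_simps)

lemma norm_x_Suc_mono:
  assumes "x t \<bullet> grad (x t) \<le> 0"
  shows "norm (x t) \<le> norm (x (Suc t))"
proof (rule power2_le_imp_le)
  have "\<eta> * (x t \<bullet> grad (x t)) \<le> 0" using assms eta_pos by (simp add: mult_nonneg_nonpos)
  moreover have "0 \<le> \<eta>\<^sup>2 * (norm (grad (x t)))\<^sup>2" by simp
  ultimately show "(norm (x t))\<^sup>2 \<le> (norm (x (Suc t)))\<^sup>2" unfolding norm_x_Suc by linarith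
qed simp

text \<open>Where the residuals are positive, \<open>resid / coef\<close> is nonincreasing in the eigenvalue; in particular
  the residuals change sign at most once, from positive to negative. The product form also covers
  \<open>coef = 0\<close>, which occurs at \<open>t = 0\<close> when \<open>r = 0\<close>.\<close>

definition sorted_resid :: "nat \<Rightarrow> bool" where
  "sorted_resid t \<longleftrightarrow> (\<forall>i\<in>{1..CARD('n)}. \<forall>j\<in>{1..CARD('n)}. i \<le> j \<longrightarrow>
     resid j t \<le> 0 \<or> 0 \<le> resid i t \<and> resid j t * coef i t \<le> resid i t * coef j t)"

text \<open>At time 0 all coefficients coincide, so the residuals are ordered oppositely to the
  eigenvalues.\<close>

lemma sorted_resid_0: "sorted_resid 0"
  unfolding sorted_resid_def
proof (intro ballI impI)
  fix i j assume ij: "i \<in> {1..CARD('n)}" "j \<in> {1..CARD('n)}" "i \<le> j"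
  have c: "0 \<le> r / norm b" using r_nonneg by simp
  have "(lam i + \<rho> * norm (x 0)) * (r / norm b) \<le> (lam j + \<rho> * norm (x 0)) * (r / norm b)"
    by (rule mult_right_mono[OF _ c]) (simp add: lam_mono[OF ij])
  then have le: "resid j 0 \<le> resid i 0" by (simp add: resid_def)
  moreover have "resid j 0 * coef i 0 \<le> resid i 0 * coef j 0"
    using mult_right_mono[OF le c] by simp
  ultimately show "resid j 0 \<le> 0 \<or> 0 \<le> resid i 0 \<and> resid j 0 * coef i 0 \<le> resid i 0 * coef j 0"
    by linarith
qed

text \<open>A residual that is positive after the step was positive before it, so the old cross
  inequality applies. It survives because \<open>shrink\<close> decreases with the
  eigenvalue.\<close>

lemma sorted_resid_Suc:
  assumes "sorted_resid t" "norm (x t) \<le> norm (x (Suc t))"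
  shows "sorted_resid (Suc t)"
  unfolding sorted_resid_def
proof (intro ballI impI)
  fix i j assume i: "i \<in> {1..CARD('n)}" and j: "j \<in> {1..CARD('n)}" and le: "i \<le> j"
  define D where "D = \<rho> * (norm (x (Suc t)) - norm (x t))"
  have D: "0 \<le> D" using assms(2) rho_pos by (simp add: D_def)
  have c: "0 < shrink i t" "0 < shrink j t" "shrink j t \<le> shrink i t"
    using shrink_lower[OF i, of t] shrink_lower[OF j, of t] shrink_antimono[OF i j le] by simp_all
  have p: "0 \<le> coef i t" "0 \<le> coef j t" "0 \<le> coef i (Suc t)" "0 \<le> coef j (Suc t)"
    using coef_nonneg[OF i] coef_nonneg[OF j] by blast+
  have q: "resid k (Suc t) = shrink k t * resid k t - D * coef k (Suc t)" for k
    by (simp only: resid_Suc D_def)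
  show "resid j (Suc t) \<le> 0 \<or>
      0 \<le> resid i (Suc t) \<and> resid j (Suc t) * coef i (Suc t) \<le> resid i (Suc t) * coef j (Suc t)"
  proof (cases "resid j (Suc t) \<le> 0")
    case False
    then have q': "0 < resid j (Suc t)" by simp
    then have "0 < shrink j t * resid j t"
      using mult_nonneg_nonneg[OF D p(4)] unfolding q by linarith
    then have qj: "0 < resid j t" using c by (simp add: zero_less_mult_iff)
    then have qi: "0 \<le> resid i t" and cross: "resid j t * coef i t \<le> resid i t * coef j t"
      using assms(1) i j le by (force simp: sorted_resid_def)+
    have "shrink j t * (resid j t * coef i t) \<le> shrink i t * (resid i t * coef j t)"
      by (rule mult_mono[OF c(3) cross]) (use c qj p in auto)
    moreover have "shrink j t * (\<eta> * (resid i t * resid j t)) \<le> shrink i t * (\<eta> * (resid i t * resid j t))"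
      using c qi qj eta_pos by (intro mult_right_mono) auto
    ultimately have "shrink j t * resid j t * coef i (Suc t) \<le> shrink i t * resid i t * coef j (Suc t)"
      unfolding coef_Suc_resid by (simp add: algebra_simps)
    \<comment> \<open>The norm increase contributes
      \<open>D * coef i (Suc t) * coef j (Suc t)\<close> to both sides and cancels.\<close>
    then have x: "resid j (Suc t) * coef i (Suc t) \<le> resid i (Suc t) * coef j (Suc t)"
      unfolding q by (simp add: algebra_simps)
    have "0 < coef j (Suc t)"
      unfolding coef_Suc_resid using p(2) qj eta_pos by (simp add: add_nonneg_pos)
    moreover have "0 \<le> resid i (Suc t) * coef j (Suc t)"
      using x q' p(3) by (meson less_imp_le mult_nonneg_nonneg order_trans)
    ultimately have "0 \<le> resid i (Suc t)" by (simp add: zero_le_mult_iff)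
    with x show ?thesis by blast
  qed simp
qed

text \<open>A Chebyshev-type argument: residuals change sign at most once and \<open>shrink\<close>
  is decreasing in the index, so taking \<open>c\<close> as the value of \<open>shrink\<close> at
  the last positive residual gives \<open>shrink i t - c\<close> and \<open>resid i t\<close>
  compatible signs.\<close>

lemma sorted_resid_threshold:
  assumes "sorted_resid t"
  obtains c where "3 / 4 \<le> c" "\<And>i. i \<in> {1..CARD('n)} \<Longrightarrow> c * resid i t \<le> shrink i t * resid i t"
proof (cases "\<exists>i\<in>{1..CARD('n)}. 0 < resid i t")
  case True
  define P where "P = {i \<in> {1..CARD('n)}. 0 < resid i t}"
  have P: "finite P" "P \<noteq> {}" using True by (auto simp: P_def)
  define k where "k = Max P"
  have "k \<in> P" using Max_in[OF P] by (simp add: k_def)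
  then have k: "k \<in> {1..CARD('n)}" "0 < resid k t" by (simp_all add: P_def)
  show thesis
  proof (rule that[of "shrink k t"])
    show "3 / 4 \<le> shrink k t" by (rule shrink_lower[OF k(1)])
    fix i assume i: "i \<in> {1..CARD('n)}"
    show "shrink k t * resid i t \<le> shrink i t * resid i t"
    proof (cases "0 < resid i t")
      case pos: True
      then have "i \<le> k" using i P by (simp add: P_def k_def)
      then show ?thesis using pos shrink_antimono[OF i k(1)] by (simp add: mult_right_mono)
    next
      case False
      consider "resid i t = 0" | "resid i t < 0" using False by linarith
      then show ?thesis
      proof cases
        case 2
        then have "\<not> i \<le> k" using assms i k by (force simp: sorted_resid_def)
        then show ?thesis
          using 2 shrink_antimono[OF k(1) i] by (intro mult_right_mono_neg) auto
      qed simp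
    qed
  qed
next
  case False
  show thesis
  \<comment> \<open>Without positive residuals the largest value of \<open>shrink\<close>
    works.\<close>
  proof (rule that[of "shrink 1 t"])
    show "3 / 4 \<le> shrink 1 t" by (rule shrink_lower[OF one_in_I])
    fix i assume i: "i \<in> {1..CARD('n)}"
    then have "resid i t \<le> 0" using False by (meson not_less)
    moreover have "shrink i t \<le> shrink 1 t" using shrink_antimono[OF one_in_I i] i by simp
    ultimately show "shrink 1 t * resid i t \<le> shrink i t * resid i t"
      by (intro mult_right_mono_neg)
  qed
qed

text \<open>Let \<open>W\<close> be minus the product of the new point with the old gradient. The
  threshold shows that shrinking the residuals keeps at least 3/4 of \<open>W\<close>; the increase
  of the norm costs at most half of \<open>W\<close>.\<close>

lemma slope_Suc:
  assumes "sorted_resid t" "x t \<bullet> grad (x t) \<le> 0"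
  shows "x (Suc t) \<bullet> grad (x (Suc t)) \<le> 0"
proof -
  define n n' where "n = norm (x t)" and "n' = norm (x (Suc t))"
  define W where "W = - (x (Suc t) \<bullet> grad (x t))"
  have nn: "0 \<le> n" "n \<le> n'" "n' \<le> R"
    using norm_x_Suc_mono[OF assms(2)] norm_x_le_R by (simp_all add: n_def n'_def)
  obtain c where c: "3 / 4 \<le> c"
      "\<And>i. i \<in> {1..CARD('n)} \<Longrightarrow> c * resid i t \<le> shrink i t * resid i t"
    using sorted_resid_threshold[OF assms(1)] by blast
  have W_eq: "W = - (x t \<bullet> grad (x t)) + \<eta> * (norm (grad (x t)))\<^sup>2"
    by (simp add: W_def x_Suc inner_diff power2_norm_eq_inner)
  have W0: "0 \<le> W" unfolding W_eq using assms(2) eta_pos by (intro add_nonneg_nonneg) auto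
  have "n'\<^sup>2 - n\<^sup>2 = 2 * \<eta> * W - \<eta>\<^sup>2 * (norm (grad (x t)))\<^sup>2"
    unfolding n_def n'_def norm_x_Suc W_eq by (simp add: power2_eq_square algebra_simps)
  then have diff: "n'\<^sup>2 - n\<^sup>2 \<le> 2 * \<eta> * W" by simp
  \<comment> \<open>Trades the increase of the norm for that of its square, which
    \<open>diff\<close> controls.\<close>
  have "(n' - n) * n'\<^sup>2 \<le> (n' - n) * (n' * (n' + n))"
    unfolding power2_eq_square using nn by (intro mult_left_mono) auto
  also have "\<dots> = n' * (n'\<^sup>2 - n\<^sup>2)" by (simp add: power2_eq_square algebra_simps)
  also have "\<dots> \<le> n' * (2 * \<eta> * W)" using diff nn by (intro mult_left_mono) auto
  also have "\<dots> \<le> R * (2 * \<eta> * W)" using nn W0 eta_pos by (intro mult_right_mono) auto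
  finally have "\<rho> * ((n' - n) * n'\<^sup>2) \<le> \<rho> * (R * (2 * \<eta> * W))"
    using rho_pos by (intro mult_left_mono) auto
  also have "\<dots> = 2 * (\<eta> * (\<rho> * R)) * W" by simp
  also have "\<dots> \<le> 1 / 2 * W"
  proof (rule mult_right_mono[OF _ W0])
    have "0 \<le> \<eta> * \<beta>" using eta_pos beta_nonneg by simp
    then show "2 * (\<eta> * (\<rho> * R)) \<le> 1 / 2" using step_bound by (simp add: distrib_left)
  qed
  finally have corr: "\<rho> * ((n' - n) * n'\<^sup>2) \<le> 1 / 2 * W" .
  have "3 / 4 * W \<le> c * W" using c(1) W0 by (rule mult_right_mono)
  also have "c * W = (\<Sum>i = 1..CARD('n). (v i \<bullet> b)\<^sup>2 * (coef i (Suc t) * (c * resid i t)))"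
    unfolding W_def x_grad_sum by (simp add: sum_distrib_left mult_ac)
  also have "\<dots> \<le> (\<Sum>i = 1..CARD('n). (v i \<bullet> b)\<^sup>2 * (coef i (Suc t) * (shrink i t * resid i t)))"
    by (intro sum_mono mult_left_mono c(2) coef_nonneg) auto
  finally have main: "3 / 4 * W \<le> \<dots>" .
  have "- (x (Suc t) \<bullet> grad (x (Suc t)))
      = (\<Sum>i = 1..CARD('n). (v i \<bullet> b)\<^sup>2 * (coef i (Suc t) * (shrink i t * resid i t)))
        - \<rho> * (n' - n) * (\<Sum>i = 1..CARD('n). (v i \<bullet> b)\<^sup>2 * (coef i (Suc t))\<^sup>2)"
    unfolding x_grad_sum resid_Suc n_def n'_def sum_distrib_left sum_subtractf[symmetric] minus_minus
    by (intro sum.cong) (simp_all add: power2_eq_square algebra_simps del: coef.simps)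
  also have "(\<Sum>i = 1..CARD('n). (v i \<bullet> b)\<^sup>2 * (coef i (Suc t))\<^sup>2) = n'\<^sup>2"
    by (simp only: norm_x_sum n'_def)
  finally show ?thesis using main corr W0 by (simp add: mult.assoc)
qed

text \<open>The two claims need a joint induction: the slope condition makes the norm increase,
  which preserves the order of the residuals, and that order preserves the slope condition.\<close>

lemma slope_nonpos: "sorted_resid t \<and> x t \<bullet> grad (x t) \<le> 0"
proof (induction t)
  case 0
  show ?case using sorted_resid_0 start_slope by blast
next
  case (Suc t)
  then show ?case using sorted_resid_Suc norm_x_Suc_mono slope_Suc by blast
qed

lemma norm_x_mono: "t \<le> t' \<Longrightarrow> norm (x t) \<le> norm (x t')"
  by (rule lift_Suc_mono_le[of "\<lambda>t. norm (x t)"]) (use norm_x_Suc_mono slope_nonpos in blast)+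

section \<open>Comparison with the norm of the minimizer\<close>

lemma gap_step: "i \<in> {1..CARD('n)} \<Longrightarrow> \<eta> * (\<rho> * norm s + lam i) \<le> 1 / 4"
proof -
  assume i: "i \<in> {1..CARD('n)}"
  have "\<rho> * norm s \<le> \<rho> * R" using norm_s_le rho_pos by (intro mult_left_mono) auto
  then have "\<rho> * norm s + lam i \<le> \<beta> + \<rho> * R" using lam_bound[OF i] by linarith
  then have "\<eta> * (\<rho> * norm s + lam i) \<le> \<eta> * (\<beta> + \<rho> * R)"
    using eta_pos by (intro mult_left_mono) auto
  then show ?thesis using step_bound by linarith
qed

text \<open>The counterpart of \<open>norm_x_sum\<close>: the minimizer has coefficients
  \<open>1 / (\<rho> * norm s + lam i)\<close>.\<close>

lemma norm_s_sum: "(norm s)\<^sup>2 = (\<Sum>i = 1..CARD('n). (v i \<bullet> b)\<^sup>2 * (1 / (\<rho> * norm s + lam i))\<^sup>2)"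
  unfolding power2_norm_eq_inner eigenbasis_inner[OF eigen, of s s]
proof (rule sum.cong)
  fix i assume i: "i \<in> {1..CARD('n)}"
  have "\<rho> * norm s + lam i \<noteq> 0" using shifted_lam_pos[OF i] by simp
  from nonzero_eq_divide_eq[OF this, of "v i \<bullet> s" "- (v i \<bullet> b)"]
  have "v i \<bullet> s = - (v i \<bullet> b) / (\<rho> * norm s + lam i)"
    using s_component[OF i] by (simp only: mult.commute)
  then show "(v i \<bullet> s) * (v i \<bullet> s) = (v i \<bullet> b)\<^sup>2 * (1 / (\<rho> * norm s + lam i))\<^sup>2"
    by (simp add: power2_eq_square)
qed simp

text \<open>If the monotone sequence of norms ever exceeded \<open>norm s\<close>, the recursion for the coefficients
  would from then on be dominated by a contraction towards the coefficients of \<open>s\<close>.\<close>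

lemma norm_x_le_s: "norm (x T) \<le> norm s"
proof (rule ccontr)
  assume "\<not> norm (x T) \<le> norm s"
  then have large: "norm s \<le> norm (x (T + k))" for k
    using norm_x_mono[of T "T + k"] by simp
  \<comment> \<open>The contraction factor of the smallest eigenvalue is the slowest one and thus
    serves all coordinates.\<close>
  define \<theta> where "\<theta> = 1 - \<eta> * (\<rho> * norm s + lam 1)"
  have "0 < \<eta> * (\<rho> * norm s + lam 1)" using gap_pos eta_pos by simp
  then have \<theta>: "0 \<le> \<theta>" "\<theta> < 1"
    using gap_step[OF one_in_I] by (simp_all add: \<theta>_def)
  have dom: "coef i (T + k) \<le> 1 / (\<rho> * norm s + lam i) + coef i T * \<theta> ^ k"
    if i: "i \<in> {1..CARD('n)}" for i k
  proof (induction k)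
    case 0
    then show ?case using shifted_lam_pos[OF i] by simp
  next
    case (Suc k)
    define g where "g = \<rho> * norm s + lam i"
    have g: "0 < g" "\<eta> * g \<le> 1 / 4" "\<rho> * norm s + lam 1 \<le> g"
      using shifted_lam_pos[OF i] gap_step[OF i] lam_min_le[OF i] by (simp_all add: g_def)
    have "\<eta> * (\<rho> * norm s + lam 1) \<le> \<eta> * g"
      using g eta_pos by (intro mult_left_mono) auto
    then have \<theta>g: "1 - \<eta> * g \<le> \<theta>" by (simp add: \<theta>_def)
    have "\<eta> * (\<rho> * norm s + lam i) \<le> \<eta> * (\<rho> * norm (x (T + k)) + lam i)"
      using large[of k] eta_pos rho_pos by (intro mult_left_mono add_right_mono) auto
    then have "shrink i (T + k) \<le> 1 - \<eta> * g"
      by (simp add: shrink_def g_def add.commute)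
    then have "coef i (T + Suc k) \<le> (1 - \<eta> * g) * coef i (T + k) + \<eta>"
      using coef_nonneg[OF i, of "T + k"] by (simp add: mult_right_mono)
    also have "\<dots> \<le> (1 - \<eta> * g) * (1 / g + coef i T * \<theta> ^ k) + \<eta>"
      using Suc g by (intro add_right_mono mult_left_mono) (auto simp: g_def)
    also have "\<dots> = 1 / g + (1 - \<eta> * g) * (coef i T * \<theta> ^ k)"
      using g by (simp add: distrib_left diff_divide_distrib)
    also have "\<dots> \<le> 1 / g + \<theta> * (coef i T * \<theta> ^ k)"
      using coef_nonneg[OF i, of T] \<theta> \<theta>g by (intro add_left_mono mult_right_mono) auto
    finally show ?case by (simp add: g_def mult_ac)
  qed
  define U where "U k = (\<Sum>i = 1..CARD('n). (v i \<bullet> b)\<^sup>2 *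
      (1 / (\<rho> * norm s + lam i) + coef i T * \<theta> ^ k)\<^sup>2)" for k
  \<comment> \<open>The left side is fixed, whereas \<open>U k\<close> tends to
    \<open>(norm s)\<^sup>2\<close>.\<close>
  have "(norm (x T))\<^sup>2 \<le> U k" for k
  proof -
    have "(norm (x T))\<^sup>2 \<le> (norm (x (T + k)))\<^sup>2"
      by (intro power_mono norm_x_mono) auto
    also have "\<dots> \<le> U k"
      unfolding norm_x_sum U_def
      by (intro sum_mono mult_left_mono power_mono dom coef_nonneg) auto
    finally show ?thesis .
  qed
  then have "\<exists>N. \<forall>k\<ge>N. (norm (x T))\<^sup>2 \<le> U k" by blast
  moreover have "U \<longlonglongrightarrow> (\<Sum>i = 1..CARD('n). (v i \<bullet> b)\<^sup>2 *
      (1 / (\<rho> * norm s + lam i) + coef i T * 0)\<^sup>2)"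
    unfolding U_def by (intro tendsto_intros LIMSEQ_realpow_zero \<theta>)
  then have "U \<longlonglongrightarrow> (norm s)\<^sup>2" by (simp only: mult_zero_right add_0_right norm_s_sum)
  ultimately have "(norm (x T))\<^sup>2 \<le> (norm s)\<^sup>2" by (rule LIMSEQ_le_const[rotated])
  then have "norm (x T) \<le> norm s" by (rule power2_le_imp_le) simp
  with \<open>\<not> norm (x T) \<le> norm s\<close> show False by simp
qed

section \<open>Growth of the first coordinate\<close>

text \<open>While the norm is too small, \<open>shrink 1\<close> is at least
  \<open>1 + \<eta> * \<mu>\<close> and the first coordinate grows geometrically. It cannot exceed
  the norm, so this phase is short.\<close>

lemma norm_growth:
  assumes mu: "0 < \<mu>"
    and t: "2 / (\<eta> * \<mu>) * ln (1 + (max (- lam 1) 0)\<^sup>2 / (4 * \<rho> * \<bar>v 1 \<bullet> b\<bar>)) \<le> real t"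
  shows "- lam 1 - \<mu> \<le> \<rho> * norm (x t)"
proof (rule ccontr)
  assume not: "\<not> - lam 1 - \<mu> \<le> \<rho> * norm (x t)"
  define \<gamma> where "\<gamma> = - lam 1"
  \<comment> \<open>Since the norms increase, a violation at time \<open>t\<close> holds at all
    earlier times.\<close>
  have low: "\<rho> * norm (x k) < \<gamma> - \<mu>" if "k \<le> t" for k
    using not mult_left_mono[OF norm_x_mono[OF that], of \<rho>] rho_pos
    unfolding \<gamma>_def by linarith
  have "0 \<le> \<rho> * norm (x t)" using rho_pos by simp
  then have \<gamma>: "\<mu> < \<gamma>" using low[of t] by simp
  have "0 \<le> \<rho> * R" using rho_pos R_nonneg by simp
  then have "\<gamma> \<le> \<beta> + \<rho> * R"
    using lam_bound[OF one_in_I] unfolding \<gamma>_def by linarith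
  then have "\<eta> * \<gamma> \<le> \<eta> * (\<beta> + \<rho> * R)"
    using eta_pos by simp
  moreover have "\<eta> * \<mu> \<le> \<eta> * \<gamma>" using \<gamma> eta_pos by simp
  ultimately have "\<eta> * \<mu> \<le> 1 / 4" using step_bound by linarith
  moreover have "0 < \<eta> * \<mu>" using mu eta_pos by simp
  ultimately have em: "0 < \<eta> * \<mu>" "\<eta> * \<mu> \<le> 1 / 4" by simp_all
  \<comment> \<open>The initial coefficient is 0 when \<open>r = 0\<close>; the growth then comes
    from the additive \<open>\<eta>\<close> of the recursion, hence the subtracted 1.\<close>
  have growth: "(1 + \<eta> * \<mu>) ^ k - 1 \<le> \<mu> * coef 1 k" if "k \<le> t" for k
    using that
  proof (induction k)
    case 0
    then show ?case using r_nonneg mu by simp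
  next
    case (Suc k)
    have "\<eta> * (lam 1 + \<rho> * norm (x k)) \<le> \<eta> * (- \<mu>)"
      using low[of k] Suc.prems eta_pos by (intro mult_left_mono) (auto simp: \<gamma>_def)
    then have "1 + \<eta> * \<mu> \<le> shrink 1 k" by (simp add: shrink_def)
    then have "(1 + \<eta> * \<mu>) * coef 1 k + \<eta> \<le> coef 1 (Suc k)"
      unfolding coef.simps using coef_nonneg[OF one_in_I, of k]
      by (intro add_right_mono mult_right_mono) auto
    then have "\<mu> * ((1 + \<eta> * \<mu>) * coef 1 k + \<eta>) \<le> \<mu> * coef 1 (Suc k)"
      using mu by (intro mult_left_mono) auto
    moreover have "(1 + \<eta> * \<mu>) * ((1 + \<eta> * \<mu>) ^ k - 1) \<le> (1 + \<eta> * \<mu>) * (\<mu> * coef 1 k)"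
      using Suc em by (intro mult_left_mono) auto
    ultimately show ?case by (simp add: algebra_simps del: coef.simps)
  qed
  have "\<mu> * coef 1 t * \<bar>v 1 \<bullet> b\<bar> * (4 * \<rho>) = 4 * (\<mu> * (\<rho> * \<bar>v 1 \<bullet> x t\<bar>))"
    unfolding x_component[OF one_in_I] using coef_nonneg[OF one_in_I, of t] by (simp add: abs_mult)
  also have "\<dots> \<le> 4 * (\<mu> * (\<rho> * norm (x t)))"
    using abs_component_le[OF one_in_I, of "x t"] mu rho_pos by simp
  also have "\<dots> < 4 * (\<mu> * (\<gamma> - \<mu>))" using low[of t] mu by simp
  \<comment> \<open>The bound \<open>4 * \<mu> * (\<gamma> - \<mu>) \<le> \<gamma>\<^sup>2\<close>
    is the source of the 4 in \<open>tau_grow\<close>.\<close>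
  also have "\<dots> \<le> \<gamma>\<^sup>2"
    using zero_le_power2[of "\<gamma> - 2 * \<mu>"] by (simp add: power2_eq_square algebra_simps)
  finally have "\<mu> * coef 1 t < \<gamma>\<^sup>2 / (4 * \<rho> * \<bar>v 1 \<bullet> b\<bar>)"
    using b1_nonzero rho_pos by (simp add: pos_less_divide_eq mult_ac)
  then have "(1 + \<eta> * \<mu>) ^ t < 1 + \<gamma>\<^sup>2 / (4 * \<rho> * \<bar>v 1 \<bullet> b\<bar>)"
    using growth[of t] by linarith
  then have "ln ((1 + \<eta> * \<mu>) ^ t) < ln (1 + \<gamma>\<^sup>2 / (4 * \<rho> * \<bar>v 1 \<bullet> b\<bar>))"
    using em zero_less_power[of "1 + \<eta> * \<mu>" t] by (subst ln_less_cancel_iff) linarith+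
  then have "real t * ln (1 + \<eta> * \<mu>) < ln (1 + \<gamma>\<^sup>2 / (4 * \<rho> * \<bar>v 1 \<bullet> b\<bar>))"
    using em by (simp add: ln_realpow)
  \<comment> \<open>For \<open>0 \<le> z \<le> 1 / 4\<close>, \<open>ln (1 + z)\<close> is at least
    \<open>z - z\<^sup>2\<close> and so at least \<open>z / 2\<close>.\<close>
  moreover have "\<eta> * \<mu> / 2 \<le> ln (1 + \<eta> * \<mu>)"
  proof -
    have "(\<eta> * \<mu>)\<^sup>2 \<le> \<eta> * \<mu> * (1 / 4)"
      unfolding power2_eq_square using em by (intro mult_left_mono) auto
    moreover have "\<eta> * \<mu> - (\<eta> * \<mu>)\<^sup>2 \<le> ln (1 + \<eta> * \<mu>)"
      using em by (intro ln_one_plus_pos_lower_bound) auto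
    ultimately show ?thesis using em by linarith
  qed
  then have "real t * (\<eta> * \<mu> / 2) \<le> real t * ln (1 + \<eta> * \<mu>)"
    by (intro mult_left_mono) auto
  moreover have "ln (1 + \<gamma>\<^sup>2 / (4 * \<rho> * \<bar>v 1 \<bullet> b\<bar>)) \<le> real t * (\<eta> * \<mu> / 2)"
  proof -
    have "max (- lam 1) 0 = \<gamma>" using \<gamma> mu by (simp add: \<gamma>_def)
    then show ?thesis using t em by (simp add: pos_divide_le_eq)
  qed
  ultimately show False by linarith
qed

section \<open>Descent and the initial optimality gap\<close>

text \<open>With both norms at most \<open>R\<close>, the cubic remainder of
  \<open>cubic_obj_add\<close> is at most \<open>\<rho> * R * (norm h)\<^sup>2\<close>. The step
  size then makes all second-order terms at most a quarter of the first-order decrease.\<close>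

lemma descent: "f (x (Suc t)) \<le> f (x t) - 3 / 4 * \<eta> * (norm (grad (x t)))\<^sup>2"
proof -
  define h where "h = - (\<eta> *\<^sub>R grad (x t))"
  define G where "G = (norm (grad (x t)))\<^sup>2"
  define n n' where "n = norm (x t)" and "n' = norm (x t + h)"
  have xh: "x (Suc t) = x t + h" by (simp add: x_Suc h_def)
  have n: "0 \<le> n" "n \<le> R" "0 \<le> n'" "n' \<le> R"
    using norm_x_le_R[of t] norm_x_le_R[of "Suc t"] by (simp_all add: n_def n'_def xh)
  have h: "(norm h)\<^sup>2 = \<eta>\<^sup>2 * G" by (simp add: h_def G_def power_mult_distrib)
  have lin: "grad (x t) \<bullet> h = - (\<eta> * G)" by (simp add: h_def G_def power2_norm_eq_inner)
  have quad: "h \<bullet> (A *v h) \<le> \<beta> * (norm h)\<^sup>2"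
    using abs_quadratic_form_le[OF onorm_le, of h] by linarith
  have "\<bar>n' - n\<bar> \<le> norm h" using norm_triangle_ineq3[of "x t + h" "x t"] by (simp add: n_def n'_def)
  then have "(n' - n)\<^sup>2 \<le> (norm h)\<^sup>2" by (simp add: abs_le_square_iff[symmetric])
  then have "(n' - n)\<^sup>2 * (n' + n / 2) \<le> (norm h)\<^sup>2 * (n' + n / 2)"
    using n by (intro mult_right_mono) auto
  then have "(n' - n)\<^sup>2 * (n' + n / 2) + 3 / 2 * n * (norm h)\<^sup>2 \<le> (norm h)\<^sup>2 * (n' + 2 * n)"
    by (simp add: algebra_simps)
  also have "\<dots> \<le> (norm h)\<^sup>2 * (3 * R)" using n by (intro mult_left_mono) auto
  finally have "\<rho> / 3 * ((n' - n)\<^sup>2 * (n' + n / 2) + 3 / 2 * n * (norm h)\<^sup>2) \<le> \<rho> / 3 * ((norm h)\<^sup>2 * (3 * R))"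
    using rho_pos by (intro mult_left_mono) auto
  also have "\<dots> = \<rho> * R * (norm h)\<^sup>2" by simp
  finally have "f (x (Suc t)) \<le> f (x t) - \<eta> * G + 1 / 2 * (\<beta> * (norm h)\<^sup>2) + \<rho> * R * (norm h)\<^sup>2"
    using quad unfolding xh cubic_obj_add[OF sym] lin n_def[symmetric] n'_def[symmetric] by linarith
  also have "\<dots> = f (x t) - \<eta> * G + \<eta> * G * (\<eta> * (\<beta> / 2 + \<rho> * R))"
    unfolding h by (simp add: power2_eq_square algebra_simps)
  also have "\<dots> \<le> f (x t) - \<eta> * G + \<eta> * G * (1 / 4)"
  proof (intro add_left_mono mult_left_mono)
    have "\<eta> * (\<beta> / 2 + \<rho> * R) \<le> \<eta> * (\<beta> + \<rho> * R)"
      using eta_pos beta_nonneg by (intro mult_left_mono) auto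
    then show "\<eta> * (\<beta> / 2 + \<rho> * R) \<le> 1 / 4" using step_bound by linarith
    show "0 \<le> \<eta> * G" using eta_pos by (simp add: G_def)
  qed
  finally show ?thesis by (simp add: G_def)
qed

lemma obj_antimono: "t \<le> t' \<Longrightarrow> f (x t') \<le> f (x t)"
proof (rule lift_Suc_antimono_le[of "\<lambda>t. f (x t)"])
  fix k
  have "0 \<le> 3 / 4 * \<eta> * (norm (grad (x k)))\<^sup>2" using eta_pos by simp
  then show "f (x (Suc k)) \<le> f (x k)" using descent[of k] by linarith
qed

text \<open>The origin is the reference point: \<open>f (x t) \<le> f (x 0) \<le> 0 = f 0\<close>,
  and \<open>cubic_obj_gap\<close> evaluates the gap of the origin.\<close>

lemma obj_gap_le: "f (x t) - f s \<le> (\<beta> + 2 * \<rho> * norm s) * (norm s)\<^sup>2 / 2"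
proof -
  have "f 0 - f s = 1 / 2 * (s \<bullet> (A *v s) + \<rho> * norm s * (norm s)\<^sup>2) + \<rho> / 6 * (norm s)\<^sup>2 * norm s"
    using cubic_obj_gap[OF sym stationary, of 0]
    by (simp add: matrix_vector_mult_diff_distrib[of A 0 s, simplified])
  moreover have "f 0 = 0" by (simp add: cubic_obj_def)
  moreover have "s \<bullet> (A *v s) \<le> \<beta> * (norm s)\<^sup>2"
    using abs_quadratic_form_le[OF onorm_le, of s] by linarith
  moreover have "f (x t) \<le> 0" using obj_antimono[of 0 t] start_obj by simp
  moreover have "0 \<le> \<rho> * norm s * (norm s)\<^sup>2" using rho_pos by simp
  ultimately show ?thesis by (simp add: algebra_simps)
qed

section \<open>Gradient dominance\<close>

lemma shifted_quadratic_form_ge: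
  "(\<rho> * norm s + lam 1) * (norm w)\<^sup>2 \<le> w \<bullet> (A *v w) + \<rho> * norm s * (norm w)\<^sup>2"
  using eigenvalue_min_le[OF sym eigen, of w] by (simp add: distrib_right)

text \<open>Two lower bounds on \<open>p\<close>, one by the gap \<open>\<Delta>\<close> and one by
  \<open>N\<close>, are multiplied; Cauchy-Schwarz bounds \<open>p * p\<close> above, and
  \<open>N\<close> cancels.\<close>

lemma gradient_dominance_gap:
  assumes "- lam 1 - (\<rho> * norm s + lam 1) / 3 \<le> \<rho> * norm y"
  shows "2 / 9 * (\<rho> * norm s + lam 1) * (f y - f s) \<le> (norm (grad y))\<^sup>2"
proof -
  define a n N g where "a = norm s" and "n = norm y" and "N = (norm (y - s))\<^sup>2"
    and "g = \<rho> * norm s + lam 1"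
  define S where "S = (y - s) \<bullet> (A *v (y - s)) + \<rho> * a * N"
  define \<Delta> where "\<Delta> = f y - f s"
  define p where "p = (y - s) \<bullet> grad y"
  have g: "0 < g" using gap_pos by (simp add: g_def)
  have pos: "0 \<le> a" "0 \<le> n" "0 \<le> N" by (simp_all add: a_def n_def N_def)
  have S: "g * N \<le> S"
    using shifted_quadratic_form_ge[of "y - s"] by (simp add: S_def g_def a_def N_def)
  have \<Delta>: "\<Delta> = S / 2 + \<rho> / 6 * (a - n)\<^sup>2 * (a + 2 * n)"
    unfolding \<Delta>_def cubic_obj_gap[OF sym stationary] by (simp add: S_def a_def n_def N_def)
  have p: "p = S - \<rho> * (a - n) / 2 * N + \<rho> / 2 * (a - n)\<^sup>2 * (a + n)"
    unfolding p_def inner_cubic_grad_stationary[OF stationary]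
    by (simp add: S_def a_def n_def N_def field_simps)
  \<comment> \<open>The assumption gives \<open>\<rho> * (a - n) \<le> 4 / 3 * g\<close>, so by
    \<open>S\<close> this term costs at most two thirds of \<open>S\<close>.\<close>
  have "\<rho> * (a - n) / 2 * N \<le> 2 / 3 * g * N"
  proof (rule mult_right_mono[OF _ pos(3)])
    have "X - Y \<le> 4 / 3 * (X + l)" if "- l - (X + l) / 3 \<le> Y" for X Y l :: real
      using that by (simp add: field_simps)
    from this[OF assms] have "\<rho> * a - \<rho> * n \<le> 4 / 3 * g"
      unfolding a_def n_def g_def .
    then show "\<rho> * (a - n) / 2 \<le> 2 / 3 * g" by (simp add: right_diff_distrib)
  qed
  then have base: "S / 3 \<le> S - \<rho> * (a - n) / 2 * N" using S by linarith
  have cub: "0 \<le> \<rho> * (a - n)\<^sup>2 * a" "0 \<le> \<rho> * (a - n)\<^sup>2 * n" using pos rho_pos by simp_all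
  have split: "\<rho> / 2 * (a - n)\<^sup>2 * (a + n) = \<rho> * (a - n)\<^sup>2 * a / 2 + \<rho> * (a - n)\<^sup>2 * n / 2"
    "2 / 3 * \<Delta> = S / 3 + \<rho> * (a - n)\<^sup>2 * a / 9 + \<rho> * (a - n)\<^sup>2 * n * 2 / 9"
    by (simp_all add: \<Delta> algebra_simps)
  have p1: "g * N / 3 \<le> p"
    using base S cub unfolding p split(1) by linarith
  have p2: "2 / 3 * \<Delta> \<le> p"
    using base cub unfolding p split by linarith
  have \<Delta>0: "0 \<le> \<Delta>" using minimizer by (simp add: \<Delta>_def)
  have "2 / 9 * g * \<Delta> * N = (2 / 3 * \<Delta>) * (g * N / 3)" by simp
  also have "\<dots> \<le> p * p"
    using p1 p2 \<Delta>0 g pos by (intro mult_mono) auto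
  also have "\<dots> \<le> (norm (grad y))\<^sup>2 * N"
    using Cauchy_Schwarz_ineq[of "y - s" "grad y"]
    unfolding p_def N_def power2_norm_eq_inner by (simp add: power2_eq_square mult.commute)
  finally have main: "2 / 9 * g * \<Delta> * N \<le> (norm (grad y))\<^sup>2 * N" .
  show ?thesis
  proof (cases "N = 0")
    case True
    then have "y = s" by (simp add: N_def)
    then show ?thesis by simp
  next
    case False
    then have "0 < N" using pos by simp
    with main show ?thesis by (simp add: g_def \<Delta>_def)
  qed
qed

text \<open>Here \<open>N \<le> 4 * a\<^sup>2\<close> replaces the curvature bound. By
  \<open>big\<close>, the error terms are small fractions of \<open>\<Delta>\<close>: the cubic term
  is at most \<open>\<Delta> / 15\<close> and the loss in \<open>p\<close> at most
  \<open>4 / 15 * \<Delta>\<close>.\<close>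

lemma gradient_dominance_sublinear:
  assumes M: "\<rho> * norm s + lam 1 \<le> M" and n: "norm y \<le> norm s"
    and low: "- lam 1 - M / 3 \<le> \<rho> * norm y"
    and big: "10 * (norm s)\<^sup>2 * M \<le> f y - f s"
  shows "2 / 9 * M * (f y - f s) \<le> (norm (grad y))\<^sup>2"
proof -
  define a n N where "a = norm s" and "n = norm y" and "N = (norm (y - s))\<^sup>2"
  define S where "S = (y - s) \<bullet> (A *v (y - s)) + \<rho> * a * N"
  define \<Delta> where "\<Delta> = f y - f s"
  define p where "p = (y - s) \<bullet> grad y"
  have M0: "0 < M" using gap_pos M by linarith
  have pos: "0 < a" "0 \<le> n" "n \<le> a" "0 \<le> N"
    using s_pos assms(2) by (simp_all add: a_def n_def N_def)
  have "norm (y - s) \<le> 2 * a"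
    using norm_triangle_ineq4[of y s] pos by (simp add: a_def n_def)
  then have "N \<le> (2 * a)\<^sup>2" unfolding N_def by (intro power_mono) auto
  then have N: "N \<le> 4 * a\<^sup>2" by simp
  have \<Delta>: "\<Delta> = S / 2 + \<rho> / 6 * (a - n)\<^sup>2 * (a + 2 * n)"
    unfolding \<Delta>_def cubic_obj_gap[OF sym stationary] by (simp add: S_def a_def n_def N_def)
  have p: "p = S - \<rho> * (a - n) / 2 * N + \<rho> / 2 * (a - n)\<^sup>2 * (a + n)"
    unfolding p_def inner_cubic_grad_stationary[OF stationary]
    by (simp add: S_def a_def n_def N_def field_simps)
  have diff: "\<rho> * (a - n) \<le> 4 / 3 * M"
    using low M by (simp add: a_def n_def algebra_simps)
  have "\<rho> * (a - n) * ((a - n) * (a + 2 * n)) \<le> 4 / 3 * M * (a * (3 * a))"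
    by (rule mult_mono[OF diff mult_mono]) (use pos M0 rho_pos in auto)
  also have "\<rho> * (a - n) * ((a - n) * (a + 2 * n)) = 6 * (\<rho> / 6 * (a - n)\<^sup>2 * (a + 2 * n))"
    by (simp add: power2_eq_square)
  also have "4 / 3 * M * (a * (3 * a)) = 6 * (2 / 3 * (a\<^sup>2 * M))"
    by (simp add: power2_eq_square)
  finally have "\<rho> / 6 * (a - n)\<^sup>2 * (a + 2 * n) \<le> 2 / 3 * (a\<^sup>2 * M)" by linarith
  moreover have big': "10 * (a\<^sup>2 * M) \<le> \<Delta>" using big by (simp add: a_def \<Delta>_def)
  ultimately have S: "28 / 15 * \<Delta> \<le> S" using \<Delta> by linarith
  have "\<rho> * (a - n) * N \<le> 4 / 3 * M * (4 * a\<^sup>2)"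
    by (rule mult_mono[OF diff N]) (use pos M0 in auto)
  then have "\<rho> * (a - n) / 2 * N \<le> 8 / 3 * (a\<^sup>2 * M)" by (simp add: mult.commute)
  moreover have "0 \<le> \<rho> / 2 * (a - n)\<^sup>2 * (a + n)" using pos rho_pos by simp
  ultimately have p1: "8 / 5 * \<Delta> \<le> p" using S big' unfolding p by linarith
  have \<Delta>0: "0 \<le> \<Delta>" using minimizer by (simp add: \<Delta>_def)
  have "a\<^sup>2 * (2 / 9 * M * \<Delta>) = 2 / 9 * (a\<^sup>2 * M) * \<Delta>" by simp
  also have "\<dots> \<le> (2 / 5 * \<Delta>) * (8 / 5 * \<Delta>)"
    using big' \<Delta>0 pos M0 by (intro mult_mono) auto
  also have "\<dots> = (8 / 5 * \<Delta>) * (8 / 5 * \<Delta>) / 4" by simp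
  also have "\<dots> \<le> p * p / 4"
    using p1 \<Delta>0 by (intro divide_right_mono mult_mono) auto
  also have "\<dots> \<le> N * (norm (grad y))\<^sup>2 / 4"
    using Cauchy_Schwarz_ineq[of "y - s" "grad y"]
    unfolding p_def N_def power2_norm_eq_inner by (simp add: power2_eq_square)
  also have "\<dots> \<le> 4 * a\<^sup>2 * (norm (grad y))\<^sup>2 / 4"
    using N by (intro divide_right_mono mult_right_mono) auto
  finally have "a\<^sup>2 * (2 / 9 * M * \<Delta>) \<le> a\<^sup>2 * (norm (grad y))\<^sup>2" by simp
  then show ?thesis using pos by (simp add: \<Delta>_def)
qed

section \<open>Convergence rate\<close>

text \<open>By contradiction: if the gap exceeds \<open>\<epsilon>\<close> at time \<open>t\<close>,
  it does so at all earlier times, as the sublinear dominance bound needs. Contraction then forces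
  the gap below \<open>\<epsilon>\<close>.\<close>

lemma convergence:
  assumes eps: "0 < \<epsilon>"
    and t: "(tau_grow \<rho> (lam 1) (v 1 \<bullet> b) + tau_converge \<rho> \<beta> s \<epsilon>) / \<eta>
      * min (1 / (\<rho> * norm s + lam 1)) (10 * (norm s)\<^sup>2 / \<epsilon>) \<le> real t"
  shows "f (x t) \<le> f s + \<epsilon>"
proof (rule ccontr)
  define \<Delta> where "\<Delta> k = f (x k) - f s" for k
  define g where "g = \<rho> * norm s + lam 1"
  define e where "e = \<epsilon> / (10 * (norm s)\<^sup>2)"
  define M where "M = max g e"
  define C where "C = (\<beta> + 2 * \<rho> * norm s) * (norm s)\<^sup>2"
  \<comment> \<open>The 6 combines 3/4 from \<open>descent\<close> with 2/9 from gradient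
    dominance.\<close>
  define \<theta> where "\<theta> = 1 - \<eta> * M / 6"
  define T1 where "T1 = tau_grow \<rho> (lam 1) (v 1 \<bullet> b) / (\<eta> * M)"
  define T2 where "T2 = tau_converge \<rho> \<beta> s \<epsilon> / (\<eta> * M)"
  define k0 where "k0 = nat \<lceil>T1\<rceil>"
  assume "\<not> f (x t) \<le> f s + \<epsilon>"
  then have far: "\<epsilon> < \<Delta> k" if "k \<le> t" for k
    using obj_antimono[OF that] by (simp add: \<Delta>_def)
  have \<Delta>C: "\<Delta> k \<le> C / 2" for k using obj_gap_le[of k] by (simp add: \<Delta>_def C_def)
  then have C: "\<epsilon> < C / 2" using far[of t] by (meson le_refl less_le_trans)
  have ge: "0 < g" "0 < e" using gap_pos eps s_pos by (simp_all add: g_def e_def)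
  then have M0: "0 < M" by (simp add: M_def)
  have minM: "min (1 / (\<rho> * norm s + lam 1)) (10 * (norm s)\<^sup>2 / \<epsilon>) = 1 / M"
  proof -
    have "10 * (norm s)\<^sup>2 / \<epsilon> = 1 / e" using s_pos by (simp add: e_def)
    moreover have "min (1 / g) (1 / e) = 1 / M"
      using ge by (auto simp: M_def min_def max_def divide_le_eq_1_pos frac_le field_simps)
    ultimately show ?thesis by (simp add: g_def)
  qed
  \<comment> \<open>The gap exceeding \<open>\<epsilon>\<close> gives
    \<open>\<epsilon> < C / 2\<close>, which keeps \<open>e\<close> within the range of the step
    size.\<close>
  have "\<eta> * e \<le> 1 / 4"
  proof -
    have "e \<le> (\<beta> + 2 * \<rho> * norm s) / 2"
      using C s_pos eps by (simp add: e_def C_def pos_divide_le_eq)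
    also have "\<dots> = \<beta> / 2 + \<rho> * norm s" by simp
    also have "\<dots> \<le> \<beta> + \<rho> * R"
      using rho_pos beta_nonneg norm_s_le by (intro add_mono mult_left_mono) auto
    finally show ?thesis using eta_pos step_bound mult_left_mono[of e "\<beta> + \<rho> * R" \<eta>] by linarith
  qed
  then have \<eta>M: "0 < \<eta> * M" "\<eta> * M \<le> 1 / 4"
    using gap_step[OF one_in_I] M0 eta_pos by (simp_all add: M_def g_def max_def)
  have T: "T1 + T2 \<le> real t"
    using t unfolding minM T1_def T2_def by (simp add: add_divide_distrib)
  have "0 \<le> T1"
    unfolding T1_def tau_grow_def using \<eta>M(1) rho_pos by simp
  moreover have "0 < T2"
    unfolding T2_def tau_converge_def C_def[symmetric]
    using C eps by (intro divide_pos_pos[OF _ \<eta>M(1)]) simp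
  ultimately have k0: "T1 \<le> real k0" "real k0 < T1 + 1" "k0 \<le> t"
    using T by (auto simp: k0_def nat_le_iff ceiling_le_iff) linarith+
  \<comment> \<open>\<open>norm_growth\<close> is used with \<open>\<mu> = M / 3\<close>, which
    turns its factor 2 into the 6 of \<open>tau_grow\<close>.\<close>
  have grown: "- lam 1 - M / 3 \<le> \<rho> * norm (x k)" if "k0 \<le> k" for k
  proof (rule norm_growth)
    have "2 / (\<eta> * (M / 3)) * ln (1 + (max (- lam 1) 0)\<^sup>2 / (4 * \<rho> * \<bar>v 1 \<bullet> b\<bar>)) = T1"
      by (simp add: T1_def tau_grow_def)
    also have "T1 \<le> real k" using k0(1) that by linarith
    finally show "2 / (\<eta> * (M / 3)) * ln (1 + (max (- lam 1) 0)\<^sup>2 / (4 * \<rho> * \<bar>v 1 \<bullet> b\<bar>)) \<le> real k" .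
  qed (use M0 in simp)
  have step: "\<Delta> (Suc k) \<le> \<theta> * \<Delta> k" if "k0 \<le> k" "k \<le> t" for k
  proof -
    have "2 / 9 * M * \<Delta> k \<le> (norm (grad (x k)))\<^sup>2"
    proof (cases "e \<le> g")
      case True
      then have "M = \<rho> * norm s + lam 1" by (simp add: M_def g_def)
      then show ?thesis
        using gradient_dominance_gap[of "x k"] grown[OF that(1)] by (simp add: \<Delta>_def)
    next
      case False
      then have "M = e" by (simp add: M_def)
      \<comment> \<open>This is why \<open>e\<close> carries the 10: \<open>far\<close> becomes the
        largeness hypothesis of the sublinear bound.\<close>
      then have "10 * (norm s)\<^sup>2 * M = \<epsilon>" using s_pos by (simp add: e_def)
      then show ?thesis unfolding \<Delta>_def
        using far[OF that(2)] grown[OF that(1)] norm_x_le_s[of k]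
        by (intro gradient_dominance_sublinear) (auto simp: \<Delta>_def M_def g_def)
    qed
    then have "3 / 4 * \<eta> * (2 / 9 * M * \<Delta> k) \<le> 3 / 4 * \<eta> * (norm (grad (x k)))\<^sup>2"
      using eta_pos by (intro mult_left_mono) auto
    moreover have "\<theta> * \<Delta> k = \<Delta> k - 3 / 4 * \<eta> * (2 / 9 * M * \<Delta> k)"
      by (simp add: \<theta>_def left_diff_distrib)
    ultimately show ?thesis using descent[of k] unfolding \<Delta>_def by linarith
  qed
  have \<theta>: "1 / 2 \<le> \<theta>" using \<eta>M unfolding \<theta>_def by linarith
  have decay: "\<Delta> (k0 + k) \<le> \<theta> ^ k * \<Delta> k0" if "k0 + k \<le> t" for k
    using that
  proof (induction k)
    case (Suc k)
    then have "\<Delta> (k0 + Suc k) \<le> \<theta> * \<Delta> (k0 + k)" using step[of "k0 + k"] by simp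
    also have "\<dots> \<le> \<theta> * (\<theta> ^ k * \<Delta> k0)" using Suc \<theta> by (intro mult_left_mono) auto
    finally show ?case by simp
  qed simp
  define m where "m = t - k0"
  txt \<open>Rounding \<open>T1\<close> up can cost one contraction step; the factor \<open>1 / 2\<close> in \<open>obj_gap_le\<close> pays for it.\<close>
  have "\<epsilon> < \<Delta> t" using far by simp
  also have "\<Delta> t \<le> \<theta> ^ m * \<Delta> k0" using decay[of m] k0(3) by (simp add: m_def)
  also have "\<dots> \<le> \<theta> ^ m * (1 / 2 * C)" using \<Delta>C[of k0] \<theta> by (intro mult_left_mono) auto
  also have "\<dots> \<le> \<theta> ^ m * (\<theta> * C)"
    using \<theta> C eps by (intro mult_left_mono mult_right_mono) auto
  also have "\<dots> = \<theta> ^ Suc m * C" by simp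
  also have "\<dots> \<le> exp (- (\<eta> * M / 6)) ^ Suc m * C"
  proof (intro mult_right_mono power_mono)
    show "\<theta> \<le> exp (- (\<eta> * M / 6))"
      using exp_ge_add_one_self[of "- (\<eta> * M / 6)"] unfolding \<theta>_def by linarith
  qed (use \<theta> C eps in auto)
  also have "\<dots> = exp (- (\<eta> * M / 6) * real (Suc m)) * C"
    by (simp only: exp_of_nat2_mult)
  also have "\<dots> \<le> exp (- ln (C / \<epsilon>)) * C"
  proof (intro mult_right_mono)
    have "T2 \<le> real (Suc m)" using T k0 by (simp add: m_def of_nat_diff)
    then have "\<eta> * M / 6 * T2 \<le> \<eta> * M / 6 * real (Suc m)" using \<eta>M by (intro mult_left_mono) auto
    moreover have "\<eta> * M / 6 * T2 = ln (C / \<epsilon>)"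
      using M0 eta_pos by (simp add: T2_def tau_converge_def C_def)
    ultimately show "exp (- (\<eta> * M / 6) * real (Suc m)) \<le> exp (- ln (C / \<epsilon>))" by simp
  qed (use C eps in simp)
  also have "\<dots> = \<epsilon>" using C eps by (simp add: exp_minus)
  finally show False by simp
qed

end

theorem theorem3p1:
  fixes A :: "real ^ 'n ^ 'n"
    and b xstar :: "real ^ 'n"
    and \<rho> \<beta> \<eta> r \<epsilon> :: real
    and lam :: "nat \<Rightarrow> real"
    and v :: "nat \<Rightarrow> real ^ 'n"
    and x :: "nat \<Rightarrow> real ^ 'n"
  assumes "transpose A = A"
    and "\<rho> > 0"
    and "ordered_eigenbasis A lam v"
    and "onorm (\<lambda>y. A *v y) \<le> \<beta>"
    and "\<forall>y. cubic_obj A b \<rho> xstar \<le> cubic_obj A b \<rho> y"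
    and "0 \<le> r" and "r \<le> R_c A b \<rho>"
    and "0 < \<eta>" and "\<eta> \<le> 1 / (4 * (\<beta> + \<rho> * R_rho b \<rho> \<beta>))"
    and "x 0 = - (r *\<^sub>R (b /\<^sub>R norm b))"
    and "\<forall>t. x (Suc t) = x t - \<eta> *\<^sub>R cubic_grad A b \<rho> (x t)"
    and "v 1 \<bullet> b \<noteq> 0"
    and "\<epsilon> > 0"
  shows "\<forall>t::nat.
    real t \<ge> (tau_grow \<rho> (lam 1) (v 1 \<bullet> b) + tau_converge \<rho> \<beta> xstar \<epsilon>) / \<eta>
               * min (1 / (\<rho> * norm xstar + lam 1)) (10 * (norm xstar)\<^sup>2 / \<epsilon>)
    \<longrightarrow> cubic_obj A b \<rho> (x t) \<le> cubic_obj A b \<rho> xstar + \<epsilon>"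
proof -
  interpret cubic_gradient_descent A b xstar \<rho> \<beta> \<eta> r lam v x
    using assms by unfold_locales
  show ?thesis using convergence[OF \<open>\<epsilon> > 0\<close>] by blast
qed

end
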